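(* Let $g\in C^1[0,1]$ satisfy $g(0)=0$, $g'(x)\neq0$ for $x\in[0,1]$, and be monotonically increasing with no inflection point in $[0,1]$; put $\sigma_0:=\max_{x\in[0,1]}|g'(x)|$ and $\delta_0:=\min_{x\in[0,1]}|g'(x)|$. Let $f\in L^1[0,1]$ be continuous on $(0,1]$, let $\Psi:=(f/g')\circ g^{-1}$ and $\Theta(y):=\Psi(g(1)y)$. If $\Theta$ is of $\mathrm{Type}(\alpha,m+1,\{0\})$ for some $\alpha\in(-1,1)$ and some $m\in\mathbb{N}$, then there exists a positive constant $c$ such that for all $\kappa>1$ and all $n\in\mathbb{N}$ satisfying $n\ge\ln\kappa_{\sigma_0}/\ln2$, $$\left|\mathcal{I}_\kappa^{\Lambda}[f,g]-\mathcal{Q}_{\kappa,n,m}^{\Lambda}[f,g]\right|\le c\,|g(1)|^{-\alpha}\,\delta_0^{\alpha-2}\,\sigma_0\,\kappa^{-2}\,\kappa_{\sigma_0}^{1-\alpha}\,\ln\kappa_{\sigma_0}\,(\beta_n^0)^{m-1},$$ and $\mathcal{N}\big(\mathcal{Q}_{\kappa,n,m}^{\Lambda}[f,g]\big)\le\lceil\sigma_0/\delta_0\rceil nm+1$.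
   Context: $\mathbb{N}=\{1,2,\dots\}$. "No inflection point in $[0,1]$" means that $g'$ is monotone on $[0,1]$. Type. For an integer $k\ge0$, a real-valued $\phi\in C^{k}((0,1])$ is of $\mathrm{Type}(\alpha,k,\{0\})$ if there is a constant $c>0$ with $|\phi^{(k)}(x)|\le c\,x^{\alpha-k}$ for all $x\in(0,1]$. $\kappa_{\sigma_0}:=\kappa$ if $\sigma_0\le1$ and $\kappa_{\sigma_0}:=\kappa\sigma_0$ if $\sigma_0>1$; $\lambda_0:=\kappa_{\sigma_0}^{-1}$; $\Lambda:=[\lambda_0,1]$; $\beta_n^0:=\kappa_{\sigma_0}^{1/n}-1$; $\mathcal{I}_\kappa^{\Lambda}[f,g]:=\int_{\lambda_0}^1f(x)e^{\mathrm{i}\kappa g(x)}\,dx$. Basic Filon-type rule. For $[a,b]\subset(0,1]$ and $m\in\mathbb{N}$, choose (arbitrary) nodes $a=t_0<t_1<\dots<t_m=b$ and let $p_m$ be the polynomial of degree at most $m$ with $p_m(g(t_j))=\Psi(g(t_j))$, $j=0,\dots,m$. Put $\mathcal{Q}^{[a,b]}_{\kappa,m}[f,g]:=\int_{g(a)}^{g(b)}p_m(x)e^{\mathrm{i}\kappa x}\,dx$. For $N\in\mathbb{N}$ let $y_j:=a+(b-a)j/N$, $j=0,\dots,N$, and $\mathcal{Q}^{[a,b]}_{N,\kappa,m}[f,g]:=\sum_{j=1}^{N}\mathcal{Q}^{[y_{j-1},y_j]}_{\kappa,m}[f,g]$. Composite rule on $\Lambda$. Let $x_j:=\kappa_{\sigma_0}^{j/n-1}$,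 $j=0,\dots,n$; for $j=1,\dots,n$ let $M_j:=\max\{|g'(x_{j-1})|,|g'(x_j)|\}$, $q_j:=M_jx_{j-1}/g(x_{j-1})$, $N_j:=\lceil q_j\rceil$. Then $\mathcal{Q}_{\kappa,n,m}^{\Lambda}[f,g]:=\sum_{j=1}^n\mathcal{Q}^{[x_{j-1},x_j]}_{N_j,\kappa,m}[f,g]$. $\mathcal{N}(F)$ denotes the number of evaluations of $\Psi$ used in the formula $F$ (an evaluation at an endpoint shared by two subintervals is counted once). *)

theory Defs
  imports "HOL-Analysis.Analysis"
begin

(* Derivatives are taken relative to S, so they are one-sided at an endpoint of S. *)
fun iter_deriv :: "real set \<Rightarrow> nat \<Rightarrow> (real \<Rightarrow> real) \<Rightarrow> real \<Rightarrow> real" where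
  "iter_deriv S 0 \<phi> = \<phi>"
| "iter_deriv S (Suc k) \<phi> = (\<lambda>x. vector_derivative (iter_deriv S k \<phi>) (at x within S))"

definition Ck_on :: "nat \<Rightarrow> real set \<Rightarrow> (real \<Rightarrow> real) \<Rightarrow> bool" where
  "Ck_on k S \<phi> \<longleftrightarrow>
     (\<forall>j<k. iter_deriv S j \<phi> differentiable_on S) \<and> continuous_on S (iter_deriv S k \<phi>)"

(* Type(alpha, k, {0}) on (0,1] *)
definition Type_zero :: "real \<Rightarrow> nat \<Rightarrow> (real \<Rightarrow> real) \<Rightarrow> bool" where
  "Type_zero \<alpha> k \<phi> \<longleftrightarrow>
     Ck_on k {0<..1} \<phi> \<and>
     (\<exists>c>0. \<forall>x\<in>{0<..1}. \<bar>iter_deriv {0<..1} k \<phi> x\<bar> \<le> c * x powr (\<alpha> - real k))"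

definition kappa_sigma :: "real \<Rightarrow> real \<Rightarrow> real" where
  "kappa_sigma \<kappa> \<sigma> = (if \<sigma> \<le> 1 then \<kappa> else \<kappa> * \<sigma>)"

definition osc_integral :: "(real \<Rightarrow> real) \<Rightarrow> (real \<Rightarrow> real) \<Rightarrow> real \<Rightarrow> real \<Rightarrow> real \<Rightarrow> complex" where
  "osc_integral f g \<kappa> a b =
     integral {a..b} (\<lambda>x. complex_of_real (f x) * exp (\<i> * complex_of_real (\<kappa> * g x)))"

(* T a b 0, ..., T a b m are the nodes chosen on the interval [a,b]. *)
definition node_choice :: "nat \<Rightarrow> (real \<Rightarrow> real \<Rightarrow> nat \<Rightarrow> real) \<Rightarrow> bool" where
  "node_choice m T \<longleftrightarrow>
     (\<forall>a b. 0 < a \<and> a < b \<and> b \<le> 1 \<longrightarrow>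
        T a b 0 = a \<and> T a b m = b \<and> (\<forall>j<m. T a b j < T a b (Suc j)))"

definition interp_poly :: "(real \<Rightarrow> real) \<Rightarrow> (real \<Rightarrow> real) \<Rightarrow> nat \<Rightarrow> (nat \<Rightarrow> real) \<Rightarrow> real poly" where
  "interp_poly \<Psi> g m t =
     (THE p. degree p \<le> m \<and> (\<forall>j\<le>m. poly p (g (t j)) = \<Psi> (g (t j))))"

definition filon ::
  "(real \<Rightarrow> real) \<Rightarrow> (real \<Rightarrow> real) \<Rightarrow> (real \<Rightarrow> real \<Rightarrow> nat \<Rightarrow> real) \<Rightarrow> real \<Rightarrow> nat \<Rightarrow> real \<Rightarrow> real \<Rightarrow> complex" where
  "filon \<Psi> g T \<kappa> m a b =
     integral {g a..g b}
       (\<lambda>x. complex_of_real (poly (interp_poly \<Psi> g m (T a b)) x) * exp (\<i> * complex_of_real (\<kappa> * x)))"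

definition unif_pt :: "real \<Rightarrow> real \<Rightarrow> nat \<Rightarrow> nat \<Rightarrow> real" where
  "unif_pt a b N j = a + (b - a) * real j / real N"

definition filon_unif ::
  "(real \<Rightarrow> real) \<Rightarrow> (real \<Rightarrow> real) \<Rightarrow> (real \<Rightarrow> real \<Rightarrow> nat \<Rightarrow> real) \<Rightarrow> nat \<Rightarrow> real \<Rightarrow> nat \<Rightarrow> real \<Rightarrow> real \<Rightarrow> complex" where
  "filon_unif \<Psi> g T N \<kappa> m a b =
     (\<Sum>j=1..N. filon \<Psi> g T \<kappa> m (unif_pt a b N (j - 1)) (unif_pt a b N j))"

(* The argument K of the following definitions stands for kappa_sigma. *)
definition graded_pt :: "real \<Rightarrow> nat \<Rightarrow> nat \<Rightarrow> real" where
  "graded_pt K n j = K powr (real j / real n - 1)"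

definition subdiv_num :: "(real \<Rightarrow> real) \<Rightarrow> (real \<Rightarrow> real) \<Rightarrow> real \<Rightarrow> nat \<Rightarrow> nat \<Rightarrow> nat" where
  "subdiv_num g g' K n j =
     (let a = graded_pt K n (j - 1); b = graded_pt K n j;
          M = max \<bar>g' a\<bar> \<bar>g' b\<bar>
      in nat \<lceil>M * a / g a\<rceil>)"

definition filon_comp ::
  "(real \<Rightarrow> real) \<Rightarrow> (real \<Rightarrow> real) \<Rightarrow> (real \<Rightarrow> real) \<Rightarrow> (real \<Rightarrow> real \<Rightarrow> nat \<Rightarrow> real) \<Rightarrow> real \<Rightarrow> real \<Rightarrow> nat \<Rightarrow> nat \<Rightarrow> complex" where
  "filon_comp \<Psi> g g' T K \<kappa> n m =
     (\<Sum>j=1..n. filon_unif \<Psi> g T (subdiv_num g g' K n j) \<kappa> m (graded_pt K n (j - 1)) (graded_pt K n j))"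

(* The sets of arguments at which each rule evaluates \<Psi>; taking unions counts an
   endpoint shared by two subintervals once. *)
definition filon_evals ::
  "(real \<Rightarrow> real) \<Rightarrow> (real \<Rightarrow> real \<Rightarrow> nat \<Rightarrow> real) \<Rightarrow> nat \<Rightarrow> real \<Rightarrow> real \<Rightarrow> real set" where
  "filon_evals g T m a b = (\<lambda>j. g (T a b j)) ` {0..m}"

definition filon_unif_evals ::
  "(real \<Rightarrow> real) \<Rightarrow> (real \<Rightarrow> real \<Rightarrow> nat \<Rightarrow> real) \<Rightarrow> nat \<Rightarrow> nat \<Rightarrow> real \<Rightarrow> real \<Rightarrow> real set" where
  "filon_unif_evals g T N m a b =
     (\<Union>j\<in>{1..N}. filon_evals g T m (unif_pt a b N (j - 1)) (unif_pt a b N j))"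

definition filon_comp_evals ::
  "(real \<Rightarrow> real) \<Rightarrow> (real \<Rightarrow> real) \<Rightarrow> (real \<Rightarrow> real \<Rightarrow> nat \<Rightarrow> real) \<Rightarrow> real \<Rightarrow> nat \<Rightarrow> nat \<Rightarrow> real set" where
  "filon_comp_evals g g' T K n m =
     (\<Union>j\<in>{1..n}. filon_unif_evals g T (subdiv_num g g' K n j) m (graded_pt K n (j - 1)) (graded_pt K n j))"

end

theory Submission
  imports Defs
begin

text \<open>Substituting \<open>y = g x\<close> turns the integral into that of \<open>\<Psi> y * exp (\<i> \<kappa> y)\<close> over
  \<open>[g (1/K), g 1]\<close>. On a panel the interpolation error of \<open>\<Psi>\<close> vanishes at \<open>m + 1\<close> points, so by
  Rolle each of its derivatives up to order \<open>m\<close> has a zero there, and on a panel of length \<open>h\<close> its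
  \<open>k\<close>-th derivative is at most \<open>h ^ (m + 1 - k)\<close> times the supremum of \<open>\<bar>\<Psi>\<^sup>(\<^sup>m\<^sup>+\<^sup>1\<^sup>)\<bar>\<close>. Since the endpoints
  are nodes, integrating by parts twice gains \<open>\<kappa>\<^sup>-\<^sup>2\<close> and leaves a multiple of \<open>h ^ m\<close>. The number of
  subdivisions of a block is chosen such that \<open>h \<le> \<beta> * g x\<^sub>j\<^sub>-\<^sub>1\<close>; this balances the singularity of
  \<open>\<Psi>\<^sup>(\<^sup>m\<^sup>+\<^sup>1\<^sup>)\<close> at 0 and makes the bound the same for all blocks, up to the monotone factor
  \<open>(g x\<^sub>j\<^sub>-\<^sub>1) powr (\<alpha> - 1)\<close>. Summing over the \<open>n\<close> blocks costs a factor \<open>n\<close>, absorbed by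
  \<open>n * \<beta> \<le> 2 * ln K\<close>.\<close>

subsection \<open>Polynomial interpolation\<close>

text \<open>Newton's construction: to add one node, a multiple of the nodal polynomial
  \<open>w\<close> is added. It vanishes at the old nodes and, by injectivity, not at the new one,
  so its coefficient can be fitted to the new value.\<close>

lemma poly_interpolation_exists:
  fixes t y :: "nat \<Rightarrow> 'a :: field"
  assumes "inj_on t {..m}"
  shows "\<exists>p. degree p \<le> m \<and> (\<forall>j\<le>m. poly p (t j) = y j)"
  using assms
proof (induction m)
  case 0
  show ?case by (rule exI[of _ "[:y 0:]"]) auto
next
  case (Suc m)
  have "inj_on t {..m}" using Suc.prems by (rule inj_on_subset) auto
  then obtain p where p: "degree p \<le> m" "\<And>j. j \<le> m \<Longrightarrow> poly p (t j) = y j"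
    using Suc.IH by blast
  define w where "w = (\<Prod>i\<le>m. [:- t i, 1:])"
  have degw: "degree w \<le> Suc m"
    unfolding w_def by (rule order.trans[OF degree_prod_sum_le]) auto
  have w0: "poly w (t j) = 0" if "j \<le> m" for j
    using that by (auto simp: w_def poly_prod)
  have w1: "poly w (t (Suc m)) \<noteq> 0"
    using inj_onD[OF Suc.prems, of "Suc m"] by (fastforce simp: w_def poly_prod)
  define q where "q = p + smult ((y (Suc m) - poly p (t (Suc m))) / poly w (t (Suc m))) w"
  have "degree q \<le> Suc m"
    unfolding q_def using p(1) degw
    by (intro degree_add_le) (auto intro: order.trans[OF degree_smult_le])
  moreover have "poly q (t j) = y j" if "j \<le> Suc m" for j
    using that p(2) w0 w1 by (cases "j = Suc m") (auto simp: q_def)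
  ultimately show ?case by blast
qed

lemma poly_interpolation_unique:
  fixes p q :: "'a :: idom poly"
  assumes inj: "inj_on t {..m}" and "degree p \<le> m" "degree q \<le> m"
    and "\<And>j. j \<le> m \<Longrightarrow> poly p (t j) = poly q (t j)"
  shows "p = q"
proof (rule ccontr)
  assume "p \<noteq> q"
  then have nz: "p - q \<noteq> 0" by simp
  have "t ` {..m} \<subseteq> {x. poly (p - q) x = 0}" using assms by auto
  then have "card (t ` {..m}) \<le> card {x. poly (p - q) x = 0}"
    by (intro card_mono poly_roots_finite nz)
  also have "\<dots> \<le> degree (p - q)" by (rule card_poly_roots_bound[OF nz])
  also have "\<dots> \<le> m" using assms by (intro degree_diff_le) auto
  finally show False by (simp add: card_image inj)
qed

text \<open>\<open>interp_poly\<close> is a definite description, so its properties rest on unique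
  existence, which holds because the images of the nodes under \<open>g\<close> are
  distinct.\<close>

lemma interp_poly_spec:
  assumes "inj_on (\<lambda>j. g (t j)) {..m}"
  shows "degree (interp_poly \<Psi> g m t) \<le> m"
    and "j \<le> m \<Longrightarrow> poly (interp_poly \<Psi> g m t) (g (t j)) = \<Psi> (g (t j))"
proof -
  have "\<exists>!p. degree p \<le> m \<and> (\<forall>j\<le>m. poly p (g (t j)) = \<Psi> (g (t j)))"
    using poly_interpolation_exists[OF assms, of "\<lambda>j. \<Psi> (g (t j))"]
    by (auto intro: poly_interpolation_unique[OF assms])
  from theI'[OF this]
  show "degree (interp_poly \<Psi> g m t) \<le> m"
    and "j \<le> m \<Longrightarrow> poly (interp_poly \<Psi> g m t) (g (t j)) = \<Psi> (g (t j))"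
    unfolding interp_poly_def by auto
qed

text \<open>This removes the interpolant from the derivative of order \<open>m + 1\<close> of the
  interpolation error.\<close>

lemma higher_pderiv_eq_0: "degree p < k \<Longrightarrow> (pderiv ^^ k) p = 0"
  by (rule poly_eqI) (simp add: coeff_higher_pderiv coeff_eq_0)

subsection \<open>Functions with many zeros\<close>

lemma zeros_of_iterated_derivative:
  fixes E :: "nat \<Rightarrow> real \<Rightarrow> real"
  assumes deriv: "\<And>k x. k < m \<Longrightarrow> x \<in> {A..B} \<Longrightarrow>
      (E k has_real_derivative E (Suc k) x) (at x within {A..B})"
    and z: "\<And>j. j \<le> m \<Longrightarrow> z j \<in> {A..B}" "\<And>j. j \<le> m \<Longrightarrow> E 0 (z j) = 0"
      "\<And>j. j < m \<Longrightarrow> z j < z (Suc j)"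
    and "k \<le> m"
  shows "\<exists>\<xi>\<in>{A..B}. E k \<xi> = 0"
proof -
  \<comment> \<open>Strengthened for the induction: \<open>E k\<close> has \<open>m - k + 1\<close>
    increasing zeros, one being lost per differentiation, so one is left at
    \<open>k = m\<close>.\<close>
  have "\<exists>w. (\<forall>j\<le>m - k. w j \<in> {A..B} \<and> E k (w j) = 0) \<and> (\<forall>j<m - k. w j < w (Suc j))"
    using \<open>k \<le> m\<close>
  proof (induction k)
    case 0
    show ?case by (rule exI[of _ z]) (use z in auto)
  next
    case (Suc k)
    then obtain w where w: "\<And>j. j \<le> m - k \<Longrightarrow> w j \<in> {A..B} \<and> E k (w j) = 0"
      "\<And>j. j < m - k \<Longrightarrow> w j < w (Suc j)" by (metis Suc_leD)
    have "\<exists>\<xi>. w j < \<xi> \<and> \<xi> < w (Suc j) \<and> E (Suc k) \<xi> = 0" if j: "j < m - k" for j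
    proof -
      have sub: "{w j..w (Suc j)} \<subseteq> {A..B}" using w(1)[of j] w(1)[of "Suc j"] j by auto
      \<comment> \<open>Rolle's theorem as the mean value theorem: the left side is 0 and the factor
        \<open>w (Suc j) - w j\<close> is not.\<close>
      have "\<exists>x\<in>{w j<..<w (Suc j)}. E k (w (Suc j)) - E k (w j) = (\<lambda>h. E (Suc k) x * h) (w (Suc j) - w j)"
      proof (rule mvt_simple)
        show "w j < w (Suc j)" using w(2) j by auto
        fix x assume "w j \<le> x" "x \<le> w (Suc j)"
        then have x: "x \<in> {w j..w (Suc j)}" by auto
        have "(E k has_real_derivative E (Suc k) x) (at x within {w j..w (Suc j)})"
          by (rule DERIV_subset[OF deriv]) (use sub x Suc.prems in auto)
        then show "(E k has_derivative (\<lambda>h. E (Suc k) x * h)) (at x within {w j..w (Suc j)})"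
          by (simp add: has_field_derivative_def)
      qed
      then show ?thesis using w(1)[of j] w(1)[of "Suc j"] w(2)[of j] j by auto
    qed
    then obtain v where v: "\<And>j. j < m - k \<Longrightarrow> w j < v j \<and> v j < w (Suc j) \<and> E (Suc k) (v j) = 0"
      by metis
    show ?case
    proof (intro exI[of _ v] conjI allI impI)
      fix j assume "j \<le> m - Suc k"
      then have "j < m - k" using Suc.prems by auto
      then show "v j \<in> {A..B}" "E (Suc k) (v j) = 0"
        using v[of j] w(1)[of j] w(1)[of "Suc j"] by auto
    next
      fix j assume "j < m - Suc k"
      then have "Suc j < m - k" by linarith
      then show "v j < v (Suc j)" using v[of j] v[of "Suc j"] by force
    qed
  qed
  then show ?thesis by blast
qed

text \<open>Induction downwards from order \<open>m + 1\<close>: since \<open>E k\<close> has a zero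
  in the interval, the mean value inequality bounds it by the length times the bound for
  \<open>E (Suc k)\<close>. The index \<open>i\<close> counts the orders descended, hence the powers
  of the length.\<close>

lemma iterated_derivative_bound:
  fixes E :: "nat \<Rightarrow> real \<Rightarrow> real"
  assumes deriv: "\<And>k x. k \<le> m \<Longrightarrow> x \<in> {A..B} \<Longrightarrow>
      (E k has_real_derivative E (Suc k) x) (at x within {A..B})"
    and zeros: "\<And>k. k \<le> m \<Longrightarrow> \<exists>\<xi>\<in>{A..B}. E k \<xi> = 0"
    and bound: "\<And>x. x \<in> {A..B} \<Longrightarrow> \<bar>E (Suc m) x\<bar> \<le> S"
    and "i \<le> Suc m" "x \<in> {A..B}"
  shows "\<bar>E (Suc m - i) x\<bar> \<le> S * (B - A) ^ i"
  using \<open>i \<le> Suc m\<close> \<open>x \<in> {A..B}\<close>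
proof (induction i arbitrary: x)
  case 0
  then show ?case using bound by simp
next
  case (Suc i)
  define k where "k = Suc m - Suc i"
  have k: "k \<le> m" "Suc m - i = Suc k" using Suc.prems by (auto simp: k_def)
  obtain \<xi> where \<xi>: "\<xi> \<in> {A..B}" "E k \<xi> = 0" using zeros[OF k(1)] by blast
  have IH: "\<bar>E (Suc k) u\<bar> \<le> S * (B - A) ^ i" if "u \<in> {A..B}" for u
    using Suc.IH[of u] that Suc.prems k by auto
  have "norm (E k x - E k \<xi>) \<le> (S * (B - A) ^ i) * norm (x - \<xi>)"
    by (rule field_differentiable_bound[where S = "{A..B}" and f' = "E (Suc k)"])
      (use deriv k IH \<xi> Suc.prems in auto)
  \<comment> \<open>The induction hypothesis at \<open>x\<close> also shows that the factor kept
    fixed is nonnegative.\<close>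
  also have "\<dots> \<le> (S * (B - A) ^ i) * (B - A)"
    using \<xi> Suc.prems IH[of x] by (intro mult_left_mono) auto
  finally show ?case using \<xi> by (simp add: k_def mult_ac)
qed

subsection \<open>Oscillatory integrals\<close>

lemma osc_integral_two_parts_bound:
  fixes E0 E1 E2 :: "real \<Rightarrow> real"
  assumes "A \<le> B" "\<kappa> > 0"
    and d0: "\<And>x. x \<in> {A..B} \<Longrightarrow> (E0 has_real_derivative E1 x) (at x within {A..B})"
    and d1: "\<And>x. x \<in> {A..B} \<Longrightarrow> (E1 has_real_derivative E2 x) (at x within {A..B})"
    and cont: "continuous_on {A..B} E2"
    and ends: "E0 A = 0" "E0 B = 0"
    and b1: "\<And>x. x \<in> {A..B} \<Longrightarrow> \<bar>E1 x\<bar> \<le> C1"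
    and b2: "\<And>x. x \<in> {A..B} \<Longrightarrow> \<bar>E2 x\<bar> \<le> C2"
  shows "cmod (integral {A..B} (\<lambda>x. of_real (E0 x) * exp (\<i> * of_real (\<kappa> * x))))
    \<le> (2 * C1 + C2 * (B - A)) / \<kappa>\<^sup>2"
proof -
  define e where "e x = exp (\<i> * complex_of_real (\<kappa> * x))" for x
  have norm_e: "cmod (e x) = 1" for x by (simp add: e_def)
  have de: "(e has_vector_derivative (\<i> * \<kappa> * e x)) (at x within {A..B})" for x
  proof -
    have "((\<lambda>z. exp (\<i> * (of_real \<kappa> * z))) has_field_derivative (\<i> * \<kappa> * e x)) (at (of_real x))"
      by (auto intro!: derivative_eq_intros simp: e_def mult_ac)
    from has_vector_derivative_real_field[OF this] show ?thesis
      by (simp add: e_def[abs_def])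
  qed
  \<comment> \<open>The boundary expression of two integrations by parts. In its derivative the two
    terms with \<open>E1\<close> cancel, which leaves the wanted integrand and the remainder
    \<open>G\<close> of size \<open>\<kappa>\<^sup>-\<^sup>2\<close>.\<close>
  define F where "F x = - \<i> / \<kappa> * (of_real (E0 x) * e x) + 1 / \<kappa>\<^sup>2 * (of_real (E1 x) * e x)" for x
  define G where "G x = of_real (E2 x) * e x / of_real (\<kappa>\<^sup>2)" for x
  have dF: "(F has_vector_derivative (of_real (E0 x) * e x + G x)) (at x within {A..B})"
    if "x \<in> {A..B}" for x
  proof -
    have v0: "((\<lambda>x. complex_of_real (E0 x)) has_vector_derivative of_real (E1 x)) (at x within {A..B})"
      using d0[OF that] by (intro has_vector_derivative_of_real) (simp add: has_real_derivative_iff_has_vector_derivative)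
    have v1: "((\<lambda>x. complex_of_real (E1 x)) has_vector_derivative of_real (E2 x)) (at x within {A..B})"
      using d1[OF that] by (intro has_vector_derivative_of_real) (simp add: has_real_derivative_iff_has_vector_derivative)
    show ?thesis
      unfolding F_def G_def
      by (rule has_vector_derivative_eq_rhs,
          rule has_vector_derivative_add[OF
            has_vector_derivative_mult_right[OF has_vector_derivative_mult[OF v0 de]]
            has_vector_derivative_mult_right[OF has_vector_derivative_mult[OF v1 de]]])
        (use \<open>\<kappa> > 0\<close> in \<open>simp add: field_simps power2_eq_square\<close>)
  qed
  have I: "((\<lambda>x. of_real (E0 x) * e x + G x) has_integral (F B - F A)) {A..B}"
    by (rule fundamental_theorem_of_calculus[OF \<open>A \<le> B\<close> dF])
  have "continuous_on {A..B} G"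
    unfolding G_def e_def using \<open>\<kappa> > 0\<close> by (intro continuous_intros cont) auto
  then have G: "G integrable_on {A..B}" by (rule integrable_continuous_real)
  have "((\<lambda>x. (of_real (E0 x) * e x + G x) - G x) has_integral (F B - F A - integral {A..B} G)) {A..B}"
    by (intro has_integral_diff I integrable_integral G)
  then have eq: "integral {A..B} (\<lambda>x. of_real (E0 x) * e x) = F B - F A - integral {A..B} G"
    by (simp add: integral_unique)
  \<comment> \<open>Where \<open>E0\<close> vanishes, the term of order 1/\<kappa> in
    \<open>F\<close> disappears; this applies at both endpoints.\<close>
  have nF: "cmod (F x) \<le> C1 / \<kappa>\<^sup>2" if "x \<in> {A..B}" "E0 x = 0" for x
    using b1[OF that(1)] that(2) \<open>\<kappa> > 0\<close> 
    by (simp add: F_def norm_mult norm_divide norm_power norm_e divide_right_mono)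
  have "cmod (integral {A..B} G) \<le> integral {A..B} (\<lambda>x. C2 / \<kappa>\<^sup>2)"
    using b2 \<open>\<kappa> > 0\<close>
    by (intro integral_norm_bound_integral G)
      (auto simp: G_def norm_mult norm_divide norm_power norm_e divide_right_mono)
  also have "\<dots> = C2 * (B - A) / \<kappa>\<^sup>2" using \<open>A \<le> B\<close> by simp
  finally have nG: "cmod (integral {A..B} G) \<le> C2 * (B - A) / \<kappa>\<^sup>2" .
  have "cmod (F B - F A - integral {A..B} G) \<le> cmod (F B) + cmod (F A) + cmod (integral {A..B} G)"
    by (meson norm_triangle_ineq4 order.trans add_mono order.refl)
  also have "\<dots> \<le> C1 / \<kappa>\<^sup>2 + C1 / \<kappa>\<^sup>2 + C2 * (B - A) / \<kappa>\<^sup>2"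
    using nF[of A] nF[of B] nG ends \<open>A \<le> B\<close> by (intro add_mono) auto
  finally show ?thesis using eq by (simp add: e_def add_divide_distrib)
qed

lemma integral_partition:
  fixes h :: "real \<Rightarrow> 'a :: banach"
  assumes "\<And>j. j < N \<Longrightarrow> p j \<le> p (Suc j)" and "h integrable_on {p 0..p N}"
  shows "integral {p 0..p N} h = (\<Sum>j=1..N. integral {p (j - 1)..p j} h)"
  using assms
proof (induction N)
  case (Suc N)
  have le: "p 0 \<le> p N"
    by (rule dec_induct[of 0 N "\<lambda>j. p 0 \<le> p j"]) (use Suc.prems(1) in \<open>auto intro: order.trans\<close>)
  have le': "p N \<le> p (Suc N)" using Suc.prems(1) by auto
  have "h integrable_on {p 0..p N}"
    by (rule integrable_subinterval_real[OF Suc.prems(2)]) (use le' in auto)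
  then have "integral {p 0..p N} h = (\<Sum>j=1..N. integral {p (j - 1)..p j} h)"
    using Suc by auto
  moreover have "integral {p 0..p N} h + integral {p N..p (Suc N)} h = integral {p 0..p (Suc N)} h"
    by (rule Henstock_Kurzweil_Integration.integral_combine[OF le le' Suc.prems(2)])
  ultimately show ?case by simp
qed simp

subsection \<open>The Filon-type rule\<close>

lemma nodes_le:
  assumes "\<And>j. j < m \<Longrightarrow> t j < (t (Suc j) :: real)" "i \<le> j" "j \<le> m"
  shows "t i \<le> t j"
  using assms(2,3)
proof (induction j rule: dec_induct)
  case (step k)
  then show ?case using assms(1)[of k] by simp
qed simp

text \<open>In the variable \<open>y\<close> the rule is interpolation at the points
  \<open>g (T a b j)\<close>, which include \<open>g a\<close> and \<open>g b\<close>;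
  \<open>D k\<close> is the derivative of order \<open>k\<close> of the interpolated function. The
  factor 3 collects two boundary terms with the first derivative of the error and one integral of
  its second derivative.\<close>

lemma filon_error:
  fixes D :: "nat \<Rightarrow> real \<Rightarrow> real"
  assumes "m \<ge> 1" "\<kappa> > 0" and mono: "strict_mono_on {a..b} g"
    and nodes: "T a b 0 = a" "T a b m = b" "\<And>j. j < m \<Longrightarrow> T a b j < T a b (Suc j)"
    and deriv: "\<And>k y. k \<le> m \<Longrightarrow> y \<in> {g a..g b} \<Longrightarrow>
      (D k has_real_derivative D (Suc k) y) (at y within {g a..g b})"
    and cont: "continuous_on {g a..g b} (D (Suc m))"
    and bound: "\<And>y. y \<in> {g a..g b} \<Longrightarrow> \<bar>D (Suc m) y\<bar> \<le> S"
  shows "cmod (integral {g a..g b} (\<lambda>y. of_real (D 0 y) * exp (\<i> * of_real (\<kappa> * y)))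
      - filon (D 0) g T \<kappa> m a b) \<le> 3 * (g b - g a) ^ m * S / \<kappa>\<^sup>2"
proof -
  have T_le: "T a b i \<le> T a b j" if "i \<le> j" "j \<le> m" for i j
    using nodes_le[of m "T a b", OF nodes(3) that] by simp
  have T_in: "T a b j \<in> {a..b}" if "j \<le> m" for j
    using T_le[of 0 j] T_le[of j m] that nodes by auto
  have "a \<le> b" using T_in[of 0] nodes by auto
  have z_less: "g (T a b j) < g (T a b (Suc j))" if "j < m" for j
    using T_in[of j] T_in[of "Suc j"] nodes(3)[OF that] that mono by (auto simp: strict_mono_on_def)
  have z_in: "g (T a b j) \<in> {g a..g b}" if "j \<le> m" for j
    using T_in[OF that] strict_mono_on_leD[OF mono] \<open>a \<le> b\<close> by auto
  have "g (T a b i) < g (T a b j)" if "i < j" "j \<le> m" for i j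
    using mono T_in[of i] T_in[of j] T_le[of "Suc i" j] nodes(3)[of i] that
    by (auto simp: strict_mono_on_def)
  then have inj: "inj_on (\<lambda>j. g (T a b j)) {..m}"
    by (intro linorder_inj_onI) force+
  define P where "P = interp_poly (D 0) g m (T a b)"
  \<comment> \<open>\<open>E k\<close> is the derivative of order \<open>k\<close> of the
    interpolation error.\<close>
  define E where "E k y = D k y - poly ((pderiv ^^ k) P) y" for k y
  note P = interp_poly_spec[where g = g and t = "T a b" and \<Psi> = "D 0", OF inj, folded P_def]
  have dE: "(E k has_real_derivative E (Suc k) y) (at y within {g a..g b})"
    if "k \<le> m" "y \<in> {g a..g b}" for k y
    unfolding E_def using deriv[OF that]
    by (auto intro!: derivative_eq_intros has_field_derivative_at_within[OF poly_DERIV])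
  have Em: "E (Suc m) y = D (Suc m) y" for y
    using P(1) by (simp add: E_def higher_pderiv_eq_0 del: funpow.simps)
  have zeros: "E 0 (g (T a b j)) = 0" if "j \<le> m" for j
    using P(2)[OF that] by (simp add: E_def)
  have "\<exists>\<xi>\<in>{g a..g b}. E k \<xi> = 0" if "k \<le> m" for k
    using dE z_in zeros z_less that
    by (intro zeros_of_iterated_derivative[where z = "\<lambda>j. g (T a b j)" and m = m]) auto
  then have E_bound: "\<bar>E (Suc m - i) y\<bar> \<le> S * (g b - g a) ^ i" if "i \<le> Suc m" "y \<in> {g a..g b}" for i y
    using that dE bound Em by (intro iterated_derivative_bound) auto
  have contE: "continuous_on {g a..g b} (E k)" if "k \<le> Suc m" for k
  proof (cases "k = Suc m")
    case True
    then show ?thesis using cont by (simp add: Em[abs_def])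
  next
    case False
    then show ?thesis using that by (intro DERIV_continuous_on[OF dE]) auto
  qed
  have le: "g a \<le> g b" using z_in[of 0] nodes by auto
  \<comment> \<open>The bounds on \<open>E 1\<close> and \<open>E 2\<close> are
    \<open>E_bound\<close> with \<open>i = m\<close> and \<open>i = m - 1\<close>; the latter
    reaches order 2 because \<open>m \<ge> 1\<close>.\<close>
  have "cmod (integral {g a..g b} (\<lambda>y. of_real (E 0 y) * exp (\<i> * of_real (\<kappa> * y))))
      \<le> (2 * (S * (g b - g a) ^ m) + (S * (g b - g a) ^ (m - 1)) * (g b - g a)) / \<kappa>\<^sup>2"
  proof (rule osc_integral_two_parts_bound[OF le \<open>\<kappa> > 0\<close>, of _ "E 1" "E 2"])
    show "E 0 (g a) = 0" "E 0 (g b) = 0" using zeros[of 0] zeros[of m] nodes by auto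
    show "continuous_on {g a..g b} (E 2)" using \<open>m \<ge> 1\<close> by (intro contE) auto
    fix y assume y: "y \<in> {g a..g b}"
    show "(E 0 has_real_derivative E 1 y) (at y within {g a..g b})" using dE[of 0] y by simp
    show "(E 1 has_real_derivative E 2 y) (at y within {g a..g b})"
      using dE[of 1] y \<open>m \<ge> 1\<close> by (simp add: numeral_2_eq_2)
    show "\<bar>E 1 y\<bar> \<le> S * (g b - g a) ^ m" using E_bound[of m y] y by simp
    have "Suc m - (m - 1) = 2" using \<open>m \<ge> 1\<close> by simp
    then show "\<bar>E 2 y\<bar> \<le> S * (g b - g a) ^ (m - 1)" using E_bound[of "m - 1" y] y by simp
  qed
  also have "\<dots> = 3 * (g b - g a) ^ m * S / \<kappa>\<^sup>2"
    using \<open>m \<ge> 1\<close> by (cases m) (auto simp: algebra_simps)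
  finally have main: "cmod (integral {g a..g b} (\<lambda>y. of_real (E 0 y) * exp (\<i> * of_real (\<kappa> * y))))
      \<le> 3 * (g b - g a) ^ m * S / \<kappa>\<^sup>2" .
  have "continuous_on {g a..g b} (D 0)"
    by (rule DERIV_continuous_on) (rule deriv, auto)
  then have i1: "(\<lambda>y. complex_of_real (D 0 y) * exp (\<i> * of_real (\<kappa> * y))) integrable_on {g a..g b}"
    by (intro integrable_continuous_real continuous_intros)
  have i2: "(\<lambda>y. complex_of_real (poly P y) * exp (\<i> * of_real (\<kappa> * y))) integrable_on {g a..g b}"
    by (intro integrable_continuous_real continuous_intros)
  show ?thesis
    using main integral_diff[OF i1 i2] unfolding filon_def P_def[symmetric]
    by (simp add: E_def left_diff_distrib)
qed

section \<open>Uniform subdivision of a block\<close>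

lemma unif_pt_0 [simp]: "unif_pt a b N 0 = a"
  and unif_pt_N [simp]: "N > 0 \<Longrightarrow> unif_pt a b N N = b"
  by (simp_all add: unif_pt_def)

lemma unif_pt_less: "a < b \<Longrightarrow> i < j \<Longrightarrow> N > 0 \<Longrightarrow> unif_pt a b N i < unif_pt a b N j"
  by (simp add: unif_pt_def divide_strict_right_mono)

lemma unif_pt_mem:
  assumes "a < b" "N > 0" "j \<le> N"
  shows "unif_pt a b N j \<in> {a..b}"
  using assms unif_pt_less[of a b 0 j N] unif_pt_less[of a b j N N]
  by (cases "j = 0"; cases "j = N") auto

lemma unif_pt_diff: "unif_pt a b N (Suc j) - unif_pt a b N j = (b - a) / real N"
  by (simp add: unif_pt_def algebra_simps add_divide_distrib diff_divide_distrib)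

text \<open>The panels have equal length in \<open>x\<close>, but the error depends on their length
  in \<open>y\<close>. The bound \<open>M\<close> on the chord slopes of \<open>g\<close> converts
  one into the other, so all \<open>N\<close> panels obey the same estimate.\<close>

lemma filon_unif_error:
  fixes D :: "nat \<Rightarrow> real \<Rightarrow> real"
  assumes "m \<ge> 1" "\<kappa> > 0" "N > 0" and ab: "0 < a" "a < b" "b \<le> 1"
    and mono: "strict_mono_on {a..b} g" and T: "node_choice m T"
    and lip: "\<And>x y. x \<in> {a..b} \<Longrightarrow> y \<in> {a..b} \<Longrightarrow> x \<le> y \<Longrightarrow> g y - g x \<le> M * (y - x)"
    and deriv: "\<And>k y. k \<le> m \<Longrightarrow> y \<in> {g a..g b} \<Longrightarrow>
      (D k has_real_derivative D (Suc k) y) (at y within {g a..g b})"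
    and cont: "continuous_on {g a..g b} (D (Suc m))"
    and bound: "\<And>y. y \<in> {g a..g b} \<Longrightarrow> \<bar>D (Suc m) y\<bar> \<le> S"
  shows "cmod (integral {g a..g b} (\<lambda>y. of_real (D 0 y) * exp (\<i> * of_real (\<kappa> * y)))
      - filon_unif (D 0) g T N \<kappa> m a b) \<le> real N * (3 * (M * ((b - a) / real N)) ^ m * S / \<kappa>\<^sup>2)"
proof -
  define h where "h y = complex_of_real (D 0 y) * exp (\<i> * of_real (\<kappa> * y))" for y
  define u where "u = unif_pt a b N"
  have u_in: "u j \<in> {a..b}" if "j \<le> N" for j unfolding u_def using that ab assms(3) by (intro unif_pt_mem)
  have u_less: "u j < u (Suc j)" for j unfolding u_def using ab assms(3) by (intro unif_pt_less) auto
  have u_ends: "u 0 = a" "u N = b" using \<open>N > 0\<close> by (auto simp: u_def)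
  have gmono: "g x \<le> g y" if "x \<in> {a..b}" "y \<in> {a..b}" "x \<le> y" for x y
    using strict_mono_on_leD[OF mono] that by auto
  \<comment> \<open>The sign of \<open>S\<close> follows from its bounding property at a single
    point.\<close>
  have "0 \<le> \<bar>D (Suc m) (g a)\<bar>" by simp
  also have "\<dots> \<le> S" using bound[of "g a"] gmono[of a b] ab by auto
  finally have "S \<ge> 0" .
  have "continuous_on {g a..g b} (D 0)"
    by (rule DERIV_continuous_on) (rule deriv, auto)
  then have "h integrable_on {g a..g b}"
    unfolding h_def by (intro integrable_continuous_real continuous_intros)
  moreover have "g (u j) \<le> g (u (Suc j))" if "j < N" for j
    using u_in[of j] u_in[of "Suc j"] u_less[of j] that by (intro gmono) auto
  ultimately have split: "integral {g a..g b} h = (\<Sum>j=1..N. integral {g (u (j - 1))..g (u j)} h)"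
    using integral_partition[of N "\<lambda>j. g (u j)" h] u_ends by auto
  have panel: "cmod (integral {g (u (j - 1))..g (u j)} h - filon (D 0) g T \<kappa> m (u (j - 1)) (u j))
      \<le> 3 * (M * ((b - a) / real N)) ^ m * S / \<kappa>\<^sup>2" if j: "j \<in> {1..N}" for j
  proof -
    have "j - 1 \<le> N" "j \<le> N" using j by auto
    then have mem: "u (j - 1) \<in> {a..b}" "u j \<in> {a..b}" by (simp_all only: u_in)
    have less: "u (j - 1) < u j" using u_less[of "j - 1"] j by auto
    have sub: "{g (u (j - 1))..g (u j)} \<subseteq> {g a..g b}"
      using gmono[of a "u (j - 1)"] gmono[of "u j" b] mem by auto
    have n: "T (u (j - 1)) (u j) 0 = u (j - 1)" "T (u (j - 1)) (u j) m = u j"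
      "\<And>i. i < m \<Longrightarrow> T (u (j - 1)) (u j) i < T (u (j - 1)) (u j) (Suc i)"
      using T mem less ab unfolding node_choice_def by auto
    have "cmod (integral {g (u (j - 1))..g (u j)} h - filon (D 0) g T \<kappa> m (u (j - 1)) (u j))
      \<le> 3 * (g (u j) - g (u (j - 1))) ^ m * S / \<kappa>\<^sup>2"
      unfolding h_def
    proof (rule filon_error[where a = "u (j - 1)" and b = "u j" and T = T and m = m,
          OF \<open>m \<ge> 1\<close> \<open>\<kappa> > 0\<close> _ n])
      show "strict_mono_on {u (j - 1)..u j} g"
        by (rule monotone_on_subset[OF mono]) (use mem in auto)
      show "continuous_on {g (u (j - 1))..g (u j)} (D (Suc m))"
        by (rule continuous_on_subset[OF cont sub])
    qed (use sub bound in \<open>auto intro: DERIV_subset[OF deriv]\<close>)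
    also have "\<dots> \<le> 3 * (M * ((b - a) / real N)) ^ m * S / \<kappa>\<^sup>2"
    proof -
      have "u j - u (j - 1) = (b - a) / real N"
        using unif_pt_diff[of a b N "j - 1"] j by (simp add: u_def)
      then have "g (u j) - g (u (j - 1)) \<le> M * ((b - a) / real N)"
        using lip[OF mem] less by auto
      moreover have "0 \<le> g (u j) - g (u (j - 1))" using gmono[OF mem] less by auto
      ultimately show ?thesis using \<open>S \<ge> 0\<close>
        by (intro divide_right_mono mult_right_mono mult_left_mono power_mono) auto
    qed
    finally show ?thesis .
  qed
  have "cmod (integral {g a..g b} h - filon_unif (D 0) g T N \<kappa> m a b)
    = cmod (\<Sum>j=1..N. integral {g (u (j - 1))..g (u j)} h - filon (D 0) g T \<kappa> m (u (j - 1)) (u j))"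
    by (simp add: split filon_unif_def u_def sum_subtractf)
  also have "\<dots> \<le> (\<Sum>j=1..N. 3 * (M * ((b - a) / real N)) ^ m * S / \<kappa>\<^sup>2)"
    by (rule sum_norm_le) (rule panel)
  finally show ?thesis by (simp add: h_def[abs_def])
qed

subsection \<open>Counting evaluations\<close>

lemma filon_evals_subset:
  assumes "T a b 0 = a"
  shows "filon_evals g T m a b \<subseteq> insert (g a) ((\<lambda>j. g (T a b j)) ` {1..m})"
proof
  fix x assume "x \<in> filon_evals g T m a b"
  then obtain j where "x = g (T a b j)" "j \<le> m" by (auto simp: filon_evals_def)
  then show "x \<in> insert (g a) ((\<lambda>j. g (T a b j)) ` {1..m})"
    using assms by (cases "j = 0") auto
qed

text \<open>The left endpoint of the first panel is kept apart so that the covers of adjacent blocks can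
  be merged without counting their common endpoint twice.\<close>

lemma filon_unif_evals_cover:
  assumes T: "node_choice m T" and "m \<ge> 1" and "N > 0" and ab: "0 < a" "a < b" "b \<le> 1"
  shows "\<exists>R. finite R \<and> card R \<le> N * m \<and> g b \<in> R \<and>
    filon_unif_evals g T N m a b \<subseteq> insert (g a) R"
proof -
  define u where "u = unif_pt a b N"
  \<comment> \<open>The node with index 0 is left out, so a panel contributes at most
    \<open>m\<close> values; its left endpoint is either \<open>g a\<close> or the right endpoint of
    the preceding panel.\<close>
  define r where "r j = (\<lambda>i. g (T (u (j - 1)) (u j) i)) ` {1..m}" for j
  define R where "R = (\<Union>j\<in>{1..N}. r j)"
  have u_in: "u j \<in> {a..b}" if "j \<le> N" for j
    unfolding u_def using that ab assms(3) by (intro unif_pt_mem)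
  have ends: "T (u (j - 1)) (u j) 0 = u (j - 1)" "T (u (j - 1)) (u j) m = u j" if "j \<in> {1..N}" for j
  proof -
    have "u (j - 1) < u j" unfolding u_def using that ab by (intro unif_pt_less) auto
    moreover have "0 < u (j - 1)" "u j \<le> 1"
      using ab u_in[of "j - 1"] u_in[of j] that by fastforce+
    ultimately show "T (u (j - 1)) (u j) 0 = u (j - 1)" "T (u (j - 1)) (u j) m = u j"
      using T unfolding node_choice_def by blast+
  qed
  have right: "g (u j) \<in> R" if "j \<in> {1..N}" for j
    using ends(2)[OF that] that \<open>m \<ge> 1\<close> unfolding R_def r_def by force
  have "filon_evals g T m (u (j - 1)) (u j) \<subseteq> insert (g a) R" if j: "j \<in> {1..N}" for j
  proof -
    have "g (u (j - 1)) \<in> insert (g a) R"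
    proof (cases "j = 1")
      case False
      then have "j - 1 \<in> {1..N}" using j by auto
      from right[OF this] show ?thesis by simp
    qed (simp add: u_def)
    moreover have "r j \<subseteq> R" using j by (auto simp: R_def)
    ultimately show ?thesis
      using filon_evals_subset[where T = T and g = g and m = m, OF ends(1)[OF j]] unfolding r_def by blast
  qed
  then have "filon_unif_evals g T N m a b \<subseteq> insert (g a) R"
    unfolding filon_unif_evals_def u_def by blast
  moreover have "finite R" by (auto simp: R_def r_def)
  moreover have "card R \<le> N * m"
  proof -
    have "card R \<le> (\<Sum>j=1..N. card (r j))" unfolding R_def by (intro card_UN_le) auto
    also have "\<dots> \<le> (\<Sum>j=1..N. m)"
      unfolding r_def by (intro sum_mono order.trans[OF card_image_le]) auto
    finally show ?thesis by simp
  qed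
  moreover have "g b \<in> R" using right[of N] \<open>N > 0\<close> by (auto simp: u_def)
  ultimately show ?thesis by blast
qed

section \<open>The geometrically graded mesh\<close>

lemma graded_pt_less:
  assumes "K > 1" "n > 0" "i < j"
  shows "graded_pt K n i < graded_pt K n j"
  using assms by (simp add: graded_pt_def divide_strict_right_mono)

lemma graded_pt_0: "K > 1 \<Longrightarrow> graded_pt K n 0 = 1 / K"
  and graded_pt_n: "K > 1 \<Longrightarrow> n > 0 \<Longrightarrow> graded_pt K n n = 1"
  by (simp_all add: graded_pt_def powr_minus_divide)

text \<open>Neighbouring mesh points have a constant ratio, so a block starting at \<open>a\<close>
  has length \<beta> times \<open>a\<close>.\<close>

lemma graded_pt_Suc:
  assumes "K > 1" "n > 0"
  shows "graded_pt K n (Suc j) = K powr (1 / real n) * graded_pt K n j"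
  using assms by (simp add: graded_pt_def powr_add[symmetric] add_divide_distrib algebra_simps)

lemma graded_pt_mem:
  assumes "K > 1" "n > 0" "j \<le> n"
  shows "graded_pt K n j \<in> {1 / K..1}"
proof -
  have "graded_pt K n 0 \<le> graded_pt K n j"
    using graded_pt_less[of K n 0 j] assms by (cases "j = 0") auto
  moreover have "graded_pt K n j \<le> graded_pt K n n"
    using graded_pt_less[of K n j n] assms by (cases "j = n") auto
  ultimately show ?thesis using assms by (simp add: graded_pt_0 graded_pt_n)
qed

text \<open>Apart from its left endpoint, a block adds at most \<open>m\<close> points per panel.
  That endpoint belongs to the cover of the preceding block, so only the very first one accounts for
  the summand 1.\<close>

lemma card_filon_comp_evals:
  assumes T: "node_choice m T" and "m \<ge> 1" "K > 1" "n > 0"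
    and N: "\<And>j. j \<in> {1..n} \<Longrightarrow> 0 < subdiv_num g g' K n j \<and> subdiv_num g g' K n j \<le> L"
  shows "card (filon_comp_evals g g' T K n m) \<le> L * n * m + 1"
proof -
  define x where "x = graded_pt K n"
  have "\<exists>R. finite R \<and> card R \<le> subdiv_num g g' K n j * m \<and> g (x j) \<in> R \<and>
      filon_unif_evals g T (subdiv_num g g' K n j) m (x (j - 1)) (x j) \<subseteq> insert (g (x (j - 1))) R"
    if j: "j \<in> {1..n}" for j
  proof (rule filon_unif_evals_cover[OF T \<open>m \<ge> 1\<close>])
    have "1 / K \<le> x (j - 1)" using graded_pt_mem[of K n "j - 1"] assms j by (auto simp: x_def)
    then show "0 < x (j - 1)" using \<open>K > 1\<close> by (smt (verit) divide_pos_pos)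
    show "x (j - 1) < x j" unfolding x_def using assms j by (intro graded_pt_less) auto
    show "x j \<le> 1" using graded_pt_mem[of K n j] assms j by (auto simp: x_def)
  qed (use N j in auto)
  then obtain R where R: "\<And>j. j \<in> {1..n} \<Longrightarrow> finite (R j) \<and> card (R j) \<le> subdiv_num g g' K n j * m
      \<and> g (x j) \<in> R j \<and>
      filon_unif_evals g T (subdiv_num g g' K n j) m (x (j - 1)) (x j) \<subseteq> insert (g (x (j - 1))) (R j)"
    by metis
  define U where "U = (\<Union>j\<in>{1..n}. R j)"
  have "insert (g (x (j - 1))) (R j) \<subseteq> insert (g (x 0)) U" if j: "j \<in> {1..n}" for j
  proof (cases "j = 1")
    case False
    then have "j - 1 \<in> {1..n}" using j by auto
    then have "g (x (j - 1)) \<in> U" using R unfolding U_def by blast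
    then show ?thesis using j by (auto simp: U_def)
  qed (use j in \<open>auto simp: U_def\<close>)
  then have sub: "filon_comp_evals g g' T K n m \<subseteq> insert (g (x 0)) U"
    unfolding filon_comp_evals_def x_def[symmetric] using R by blast
  have fin: "finite U" using R by (auto simp: U_def)
  have "card U \<le> (\<Sum>j=1..n. card (R j))" unfolding U_def by (intro card_UN_le) auto
  also have "\<dots> \<le> (\<Sum>j=1..n. L * m)"
  proof (intro sum_mono)
    fix j assume j: "j \<in> {1..n}"
    have "card (R j) \<le> subdiv_num g g' K n j * m" using R j by auto
    also have "\<dots> \<le> L * m" using N j by (intro mult_right_mono) auto
    finally show "card (R j) \<le> L * m" .
  qed
  finally have "card U \<le> L * n * m" by (simp add: mult_ac)
  moreover have "card (filon_comp_evals g g' T K n m) \<le> card (insert (g (x 0)) U)"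
    using sub fin by (intro card_mono) auto
  moreover have "card (insert (g (x 0)) U) \<le> Suc (card U)" by (rule card_insert_le_m1) auto
  ultimately show ?thesis by linarith
qed

subsection \<open>The composite rule\<close>

text \<open>From \<open>1 - u \<le> exp (- u)\<close> follows
  \<open>exp u - 1 \<le> u * exp u\<close>, and \<open>exp u\<close> is at most 2 in this
  range.\<close>

lemma exp_diff_1_le:
  fixes u :: real
  assumes "0 \<le> u" "u \<le> ln 2"
  shows "exp u - 1 \<le> 2 * u"
proof -
  have "exp u \<le> exp (ln 2)" using assms by (subst exp_le_cancel_iff)
  then have "exp u \<le> 2" by simp
  have "(1 - u) * exp u \<le> exp (- u) * exp u"
    using exp_ge_add_one_self[of "- u"] by (intro mult_right_mono) auto
  then have "exp u - 1 \<le> u * exp u" by (simp add: algebra_simps flip: exp_add)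
  also have "\<dots> \<le> u * 2" using \<open>exp u \<le> 2\<close> assms by (intro mult_left_mono) auto
  finally show ?thesis by simp
qed

text \<open>The lower bound on \<open>n\<close> says that the exponent \<open>u = ln K / n\<close>
  is at most \<open>ln 2\<close>, that is, that the mesh ratio \<open>exp u\<close> is at most 2.
  The sum over \<open>n\<close> blocks then costs only a factor \<open>ln K\<close>.\<close>

lemma grading_ratio_bound:
  assumes "K > 1" "n > 0" "real n \<ge> ln K / ln 2"
  shows "real n * (K powr (1 / real n) - 1) \<le> 2 * ln K"
proof -
  have "ln K / real n \<le> ln 2" using assms by (simp add: field_simps)
  then have "exp (ln K / real n) - 1 \<le> 2 * (ln K / real n)"
    using assms by (intro exp_diff_1_le) auto
  then have "K powr (1 / real n) - 1 \<le> 2 * ln K / real n"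
    using assms by (simp add: powr_def)
  then show ?thesis using assms by (simp add: field_simps)
qed

text \<open>The quotient under the ceiling is positive, and at most \<sigma>/\<delta> because
  \<open>g a \<ge> \<delta> * a\<close>. The third fact is the ceiling inequality without its
  denominator, the form in which it bounds panel lengths in \<open>y\<close>.\<close>

lemma subdiv_num_bounds:
  assumes "K > 1" "n > 0" "j \<in> {1..n}" "\<delta> > 0"
    and g': "\<And>x. x \<in> {0..1} \<Longrightarrow> g' x \<noteq> 0 \<and> \<bar>g' x\<bar> \<le> \<sigma>"
    and lower: "\<And>x. x \<in> {0..1} \<Longrightarrow> \<delta> * x \<le> g x"
  shows "0 < subdiv_num g g' K n j" "subdiv_num g g' K n j \<le> nat \<lceil>\<sigma> / \<delta>\<rceil>"
    and "max \<bar>g' (graded_pt K n (j - 1))\<bar> \<bar>g' (graded_pt K n j)\<bar> * graded_pt K n (j - 1)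
      \<le> real (subdiv_num g g' K n j) * g (graded_pt K n (j - 1))"
proof -
  define a b where "a = graded_pt K n (j - 1)" and "b = graded_pt K n j"
  define M where "M = max \<bar>g' a\<bar> \<bar>g' b\<bar>"
  have ab: "a \<in> {1 / K..1}" "b \<in> {1 / K..1}"
    unfolding a_def b_def using assms(3)
    by (auto intro!: graded_pt_mem[OF assms(1,2)] simp del: atLeastAtMost_iff
        simp: atLeastAtMost_iff[of j])
  have "0 < 1 / K" using \<open>K > 1\<close> by simp
  then have a: "0 < a" "a \<le> 1" and b: "0 < b" "b \<le> 1"
    using ab unfolding atLeastAtMost_iff by linarith+
  have M: "0 < M" "M \<le> \<sigma>" using g'[of a] g'[of b] a b by (auto simp: M_def)
  have "0 < \<delta> * a" using a \<open>\<delta> > 0\<close> by simp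
  then have ga: "\<delta> * a \<le> g a" "0 < g a" using lower[of a] a by auto
  have N: "subdiv_num g g' K n j = nat \<lceil>M * a / g a\<rceil>"
    by (simp add: subdiv_num_def a_def b_def M_def Let_def)
  have q: "M * a / g a > 0" using M a ga by simp
  then show "0 < subdiv_num g g' K n j" by (simp add: N)
  have "M * a / g a \<le> \<sigma> * a / (\<delta> * a)"
    using M a ga \<open>\<delta> > 0\<close> by (intro frac_le mult_right_mono) auto
  also have "\<dots> = \<sigma> / \<delta>" using a by simp
  finally show "subdiv_num g g' K n j \<le> nat \<lceil>\<sigma> / \<delta>\<rceil>"
    unfolding N by (intro nat_mono ceiling_mono)
  have "M * a / g a \<le> real (subdiv_num g g' K n j)" unfolding N using q by linarith
  then have "M * a \<le> real (subdiv_num g g' K n j) * g a" using ga by (simp add: pos_divide_le_eq)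
  then show "max \<bar>g' (graded_pt K n (j - 1))\<bar> \<bar>g' (graded_pt K n j)\<bar> * graded_pt K n (j - 1)
      \<le> real (subdiv_num g g' K n j) * g (graded_pt K n (j - 1))"
    by (simp add: M_def a_def b_def)
qed

text \<open>\<open>K\<close> governs only the grading and is kept independent of \<kappa>; the
  factor \<open>\<kappa>\<^sup>-\<^sup>2\<close> comes from each panel. The derivatives
  \<open>D k\<close> are given on a half-open interval, as they may be singular at 0, and every
  block stays away from 0.\<close>

lemma filon_comp_error:
  fixes D :: "nat \<Rightarrow> real \<Rightarrow> real"
  assumes "m \<ge> 1" "\<kappa> > 0" "K > 1" "n > 0" and T: "node_choice m T"
    and n: "real n \<ge> ln K / ln 2"
    and mono: "strict_mono_on {0..1} g"
    and \<delta>: "0 < \<delta>" "\<delta> \<le> \<sigma>"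
    and g': "\<And>x. x \<in> {0..1} \<Longrightarrow> g' x \<noteq> 0 \<and> \<bar>g' x\<bar> \<le> \<sigma>"
    and lower: "\<And>x. x \<in> {0..1} \<Longrightarrow> \<delta> * x \<le> g x"
    and lip: "\<And>a b x y. 0 \<le> a \<Longrightarrow> a \<le> x \<Longrightarrow> x \<le> y \<Longrightarrow> y \<le> b \<Longrightarrow> b \<le> 1 \<Longrightarrow>
      g y - g x \<le> max \<bar>g' a\<bar> \<bar>g' b\<bar> * (y - x)"
    and deriv: "\<And>k y. k \<le> m \<Longrightarrow> y \<in> {0<..g 1} \<Longrightarrow>
      (D k has_real_derivative D (Suc k) y) (at y within {0<..g 1})"
    and cont: "continuous_on {0<..g 1} (D (Suc m))"
    and \<alpha>: "\<alpha> < 1" and C: "C \<ge> 0"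
    and bound: "\<And>y. y \<in> {0<..g 1} \<Longrightarrow> \<bar>D (Suc m) y\<bar> \<le> C * y powr (\<alpha> - real (m + 1))"
  defines "\<beta> \<equiv> K powr (1 / real n) - 1"
  shows "cmod (integral {g (1 / K)..g 1} (\<lambda>y. of_real (D 0 y) * exp (\<i> * of_real (\<kappa> * y)))
      - filon_comp (D 0) g g' T K \<kappa> n m)
    \<le> 12 * C * \<delta> powr (\<alpha> - 2) * \<sigma> * inverse (\<kappa>\<^sup>2) * K powr (1 - \<alpha>) * ln K * \<beta> ^ (m - 1)"
proof -
  define h where "h y = complex_of_real (D 0 y) * exp (\<i> * of_real (\<kappa> * y))" for y
  define x where "x = graded_pt K n"
  define N where "N = subdiv_num g g' K n"
  have "1 / K > 0" using \<open>K > 1\<close> by simp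
  have x_mem: "1 / K \<le> x j" "x j \<le> 1" "0 < x j" if "j \<le> n" for j
    using graded_pt_mem[OF \<open>K > 1\<close> \<open>n > 0\<close> that] \<open>1 / K > 0\<close>
    unfolding x_def atLeastAtMost_iff by linarith+
  have x_less: "x j < x (Suc j)" for j unfolding x_def using assms by (intro graded_pt_less) auto
  have x_ends: "x 0 = 1 / K" "x n = 1" using assms by (auto simp: x_def graded_pt_0 graded_pt_n)
  have \<beta>0: "\<beta> \<ge> 0"
    using ge_one_powr_ge_zero[of K "1 / real n"] assms by (simp add: \<beta>_def)
  have gmono: "g s \<le> g t" if "0 \<le> s" "s \<le> t" "t \<le> 1" for s t
    using strict_mono_on_leD[OF mono, of s t] that by auto
  have gpos: "0 < g s" if "0 < s" "s \<le> 1" for s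
    using lower[of s] that \<delta> by (smt (verit) atLeastAtMost_iff mult_pos_pos)
  have contD: "continuous_on {0<..g 1} (D 0)"
    by (rule DERIV_continuous_on) (rule deriv, auto)
  have "{g (1 / K)..g 1} \<subseteq> {0<..g 1}" using gpos[of "1 / K"] \<open>K > 1\<close> by auto
  then have "h integrable_on {g (1 / K)..g 1}" unfolding h_def
    by (intro integrable_continuous_real continuous_intros continuous_on_subset[OF contD])
  moreover have "g (x j) \<le> g (x (Suc j))" if "j < n" for j
    using x_less[of j] x_mem[of j] x_mem[of "Suc j"] that by (intro gmono) auto
  ultimately have split: "integral {g (1 / K)..g 1} h = (\<Sum>j=1..n. integral {g (x (j - 1))..g (x j)} h)"
    using integral_partition[of n "\<lambda>j. g (x j)" h] x_ends by auto
  \<comment> \<open>A bound valid for every block: 2\<sigma>/\<delta> for the number of panels, the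
    error of one panel, and the largest possible value of \<open>g a powr (\<alpha> - 1)\<close>,
    using \<open>g a \<ge> \<delta> / K\<close>.\<close>
  define E where "E = 2 * \<sigma> / \<delta> * (3 * C / \<kappa>\<^sup>2) * \<beta> ^ m * (\<delta> powr (\<alpha> - 1) * K powr (1 - \<alpha>))"
  have block: "cmod (integral {g (x (j - 1))..g (x j)} h
      - filon_unif (D 0) g T (N j) \<kappa> m (x (j - 1)) (x j)) \<le> E" if j: "j \<in> {1..n}" for j
  proof -
    define a b where "a = x (j - 1)" and "b = x j"
    define M where "M = max \<bar>g' a\<bar> \<bar>g' b\<bar>"
    have a: "1 / K \<le> a" "0 < a" "a \<le> 1" and b: "0 < b" "b \<le> 1" and less: "a < b"
      using x_mem[of "j - 1"] x_mem[of j] x_less[of "j - 1"] j by (auto simp: a_def b_def)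
    have diff: "b - a = \<beta> * a"
      using graded_pt_Suc[of K n "j - 1"] assms j by (simp add: a_def b_def x_def \<beta>_def algebra_simps)
    note N = subdiv_num_bounds[where g = g and g' = g' and \<sigma> = \<sigma> and \<delta> = \<delta>, OF \<open>K > 1\<close> \<open>n > 0\<close> j \<delta>(1) g' lower, folded N_def x_def, folded a_def b_def, folded M_def]
    have N0: "N j > 0" using N(1) by simp
    have ga: "g a > 0" "g a \<ge> \<delta> * a" using gpos[of a] lower[of a] a by auto
    have sub: "{g a..g b} \<subseteq> {0<..g 1}" using ga gmono[of b 1] b by auto
    \<comment> \<open>The exponent is negative, so the bound on \<open>D (Suc m)\<close> is largest
      at the left end of the block.\<close>
    define S where "S = C * g a powr (\<alpha> - real (m + 1))"
    have "cmod (integral {g a..g b} h - filon_unif (D 0) g T (N j) \<kappa> m a b)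
      \<le> real (N j) * (3 * (M * ((b - a) / real (N j))) ^ m * S / \<kappa>\<^sup>2)"
      unfolding h_def
    proof (rule filon_unif_error[OF \<open>m \<ge> 1\<close> \<open>\<kappa> > 0\<close> N0 a(2) less b(2) _ T])
      show "strict_mono_on {a..b} g" by (rule monotone_on_subset[OF mono]) (use a b in auto)
      show "continuous_on {g a..g b} (D (Suc m))" by (rule continuous_on_subset[OF cont sub])
      show "g t - g s \<le> M * (t - s)" if "s \<in> {a..b}" "t \<in> {a..b}" "s \<le> t" for s t
        using lip[of a s t b] that a b by (auto simp: M_def)
      show "(D k has_real_derivative D (Suc k) y) (at y within {g a..g b})"
        if "k \<le> m" "y \<in> {g a..g b}" for k y
        by (rule DERIV_subset[OF deriv sub]) (use that sub in auto)
      fix y assume y: "y \<in> {g a..g b}"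
      have "\<bar>D (Suc m) y\<bar> \<le> C * y powr (\<alpha> - real (m + 1))" using y sub by (intro bound) auto
      also have "\<dots> \<le> S" unfolding S_def
        using y ga \<alpha> C by (intro mult_left_mono powr_mono2') auto
      finally show "\<bar>D (Suc m) y\<bar> \<le> S" .
    qed
    also have "\<dots> \<le> (2 * \<sigma> / \<delta>) * (3 * (\<beta> * g a) ^ m * S / \<kappa>\<^sup>2)"
    proof -
      \<comment> \<open>Rounding up adds at most 1, which is itself at most
        \<sigma>/\<delta>.\<close>
      have "real (N j) \<le> \<sigma> / \<delta> + 1" using N(2) \<delta> N0 by linarith
      also have "\<dots> \<le> 2 * \<sigma> / \<delta>" using \<delta> by (simp add: field_simps)
      finally have Nj: "real (N j) \<le> 2 * \<sigma> / \<delta>" .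
      \<comment> \<open>The key use of the subdivision number: it replaces \<open>M * a\<close> by
        \<open>N j * g a\<close>, so that division by \<open>N j\<close> leaves a length
        proportional to \<open>g a\<close>, free of \<open>M\<close>.\<close>
      have "M * (b - a) = \<beta> * (M * a)" by (simp add: diff)
      also have "\<dots> \<le> \<beta> * (real (N j) * g a)" using N(3) \<beta>0 by (intro mult_left_mono)
      finally have h: "M * ((b - a) / real (N j)) \<le> \<beta> * g a" using N0 by (simp add: field_simps)
      have "0 \<le> M * ((b - a) / real (N j))" "S \<ge> 0" using less C by (auto simp: M_def S_def)
      then have "3 * (M * ((b - a) / real (N j))) ^ m * S / \<kappa>\<^sup>2 \<le> 3 * (\<beta> * g a) ^ m * S / \<kappa>\<^sup>2"
        "0 \<le> 3 * (M * ((b - a) / real (N j))) ^ m * S / \<kappa>\<^sup>2"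
        using h by (auto intro!: divide_right_mono mult_right_mono power_mono simp del: times_divide_eq_right)
      then show ?thesis using Nj \<delta> by (intro mult_mono) auto
    qed
    also have "\<dots> = 2 * \<sigma> / \<delta> * (3 * C / \<kappa>\<^sup>2) * \<beta> ^ m * g a powr (\<alpha> - 1)"
    proof -
      \<comment> \<open>The \<open>m\<close> powers of the panel length offset \<open>m\<close>
        orders of the singularity.\<close>
      have "g a ^ m * g a powr (\<alpha> - real (m + 1)) = g a powr (\<alpha> - 1)"
        using ga by (simp add: powr_realpow[symmetric] powr_add[symmetric])
      then show ?thesis by (simp add: S_def power_mult_distrib field_simps)
    qed
    also have "\<dots> \<le> E"
      unfolding E_def
    proof (intro mult_left_mono)
      have "\<delta> * (1 / K) \<le> g a"
        using ga a \<delta> by (intro order.trans[OF mult_left_mono ga(2)]) auto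
      then have "g a powr (\<alpha> - 1) \<le> (\<delta> * (1 / K)) powr (\<alpha> - 1)"
        using \<delta> \<open>1 / K > 0\<close> \<alpha> by (intro powr_mono2') auto
      also have "\<dots> = \<delta> powr (\<alpha> - 1) * (1 / K) powr (\<alpha> - 1)"
        using \<delta> \<open>K > 1\<close> by (intro powr_mult) 
      also have "(1 / K) powr (\<alpha> - 1) = K powr (1 - \<alpha>)"
        using \<open>K > 1\<close> by (simp add: powr_divide flip: powr_minus_divide)
      finally show "g a powr (\<alpha> - 1) \<le> \<delta> powr (\<alpha> - 1) * K powr (1 - \<alpha>)" .
    qed (use C \<delta> \<beta>0 in auto)
    finally show ?thesis by (simp add: a_def b_def)
  qed
  have "cmod (integral {g (1 / K)..g 1} h - filon_comp (D 0) g g' T K \<kappa> n m)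
    = cmod (\<Sum>j=1..n. integral {g (x (j - 1))..g (x j)} h
        - filon_unif (D 0) g T (N j) \<kappa> m (x (j - 1)) (x j))"
    by (simp add: split filon_comp_def x_def N_def sum_subtractf)
  also have "\<dots> \<le> (\<Sum>j=1..n. E)" by (rule sum_norm_le) (rule block)
  \<comment> \<open>One factor of \<open>\<beta> ^ m\<close> is split off to be absorbed together
    with the number \<open>n\<close> of blocks.\<close>
  also have "\<dots> = (real n * \<beta>)
      * (6 * C * (\<delta> powr (\<alpha> - 1) / \<delta>) * \<sigma> * inverse (\<kappa>\<^sup>2) * K powr (1 - \<alpha>) * \<beta> ^ (m - 1))"
    using \<open>m \<ge> 1\<close> by (cases m) (auto simp: E_def field_simps)
  also have "\<dots> \<le> (2 * ln K)
      * (6 * C * (\<delta> powr (\<alpha> - 1) / \<delta>) * \<sigma> * inverse (\<kappa>\<^sup>2) * K powr (1 - \<alpha>) * \<beta> ^ (m - 1))"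
    using grading_ratio_bound[OF \<open>K > 1\<close> \<open>n > 0\<close> n] C \<delta> \<beta>0
    by (intro mult_right_mono) (auto simp: \<beta>_def)
  also have "\<delta> powr (\<alpha> - 1) / \<delta> = \<delta> powr (\<alpha> - 2)"
    using powr_diff[of \<delta> "\<alpha> - 1" 1] \<delta> by simp
  finally show ?thesis by (simp add: h_def[abs_def] mult_ac)
qed

section \<open>Change of variables and derivatives within a set\<close>

lemma osc_integral_substitution:
  assumes "a \<le> b" "mono_on {a..b} g"
    and deriv: "\<And>x. x \<in> {a..b} \<Longrightarrow> (g has_real_derivative g' x) (at x within {a..b})"
    and cont: "continuous_on {g a..g b} \<Psi>"
    and f: "\<And>x. x \<in> {a..b} \<Longrightarrow> f x = g' x * \<Psi> (g x)"
  shows "osc_integral f g \<kappa> a b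
    = integral {g a..g b} (\<lambda>y. of_real (\<Psi> y) * exp (\<i> * of_real (\<kappa> * y)))"
proof -
  define h where "h y = complex_of_real (\<Psi> y) * exp (\<i> * of_real (\<kappa> * y))" for y
  have "g a \<le> g b" using assms(1,2) by (auto simp: mono_on_def)
  moreover have "g ` {a..b} \<subseteq> {g a..g b}" using assms(1,2) by (auto simp: mono_on_def)
  moreover have "continuous_on {g a..g b} h" unfolding h_def by (intro continuous_intros cont)
  ultimately have "((\<lambda>x. g' x *\<^sub>R h (g x)) has_integral integral {g a..g b} h) {a..b}"
    using \<open>a \<le> b\<close> deriv by (intro has_integral_substitution) auto
  moreover have "g' x *\<^sub>R h (g x) = of_real (f x) * exp (\<i> * of_real (\<kappa> * g x))" if "x \<in> {a..b}" for x
    using f[OF that] by (simp add: h_def scaleR_conv_of_real)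
  ultimately have "((\<lambda>x. of_real (f x) * exp (\<i> * of_real (\<kappa> * g x))) has_integral integral {g a..g b} h) {a..b}"
    by (rule has_integral_eq[rotated])
  then show ?thesis unfolding osc_integral_def h_def[abs_def] by (rule integral_unique)
qed

text \<open>\<open>iter_deriv\<close> is built from \<open>vector_derivative\<close>, which is a
  genuine derivative where the function is differentiable; \<open>Ck_on\<close> ensures this for the
  orders below \<open>k\<close>.\<close>

lemma iter_deriv_has_derivative:
  assumes "Ck_on k S \<phi>" "j < k" "x \<in> S"
  shows "(iter_deriv S j \<phi> has_real_derivative iter_deriv S (Suc j) \<phi> x) (at x within S)"
proof -
  have "iter_deriv S j \<phi> differentiable (at x within S)"
    using assms by (auto simp: Ck_on_def differentiable_on_def)
  then show ?thesis
    by (simp add: has_real_derivative_iff_has_vector_derivative vector_derivative_works)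
qed

text \<open>A negative derivative would force a strict decrease to the right of \<open>x\<close>,
  or, at the right endpoint, larger values to its left.\<close>

lemma mono_on_deriv_nonneg:
  fixes g :: "real \<Rightarrow> real"
  assumes "mono_on {a..b} g" "a < b" "x \<in> {a..b}"
    and deriv: "(g has_real_derivative l) (at x within {a..b})"
  shows "l \<ge> 0"
proof (rule ccontr)
  assume "\<not> l \<ge> 0"
  then have "l < 0" by simp
  show False
  proof (cases "x < b")
    case True
    obtain d where d: "d > 0" "\<And>h. 0 < h \<Longrightarrow> x + h \<in> {a..b} \<Longrightarrow> h < d \<Longrightarrow> g x > g (x + h)"
      using has_real_derivative_neg_dec_right[OF deriv \<open>l < 0\<close>] by blast
    define h where "h = min (d / 2) (b - x)"
    have h: "0 < h" "h < d" "x + h \<in> {a..b}" using d(1) True assms(3) by (auto simp: h_def min_def)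
    then have "g x > g (x + h)" by (intro d(2))
    moreover have "g x \<le> g (x + h)" using h assms by (intro mono_onD[OF assms(1)]) auto
    ultimately show False by simp
  next
    case False
    then have "x = b" using assms(3) by auto
    obtain d where d: "d > 0" "\<And>h. 0 < h \<Longrightarrow> x - h \<in> {a..b} \<Longrightarrow> h < d \<Longrightarrow> g x < g (x - h)"
      using has_real_derivative_neg_dec_left[OF deriv \<open>l < 0\<close>] by blast
    define h where "h = min (d / 2) (b - a)"
    have h: "0 < h" "h < d" "x - h \<in> {a..b}" using d(1) \<open>a < b\<close> \<open>x = b\<close> by (auto simp: h_def min_def)
    then have "g x < g (x - h)" by (intro d(2))
    moreover have "g (x - h) \<le> g x" using h assms by (intro mono_onD[OF assms(1)]) auto
    ultimately show False by simp
  qed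
qed

text \<open>The constant is fixed before \<kappa>, \<open>n\<close> and \<open>T\<close>, so the
  estimate is uniform in the choice of nodes, which may differ from panel to panel.\<close>

theorem theorem4p8:
  fixes f g g' \<Psi> \<Theta> :: "real \<Rightarrow> real" and \<sigma>0 \<delta>0 \<alpha> :: real and m :: nat
  assumes g_deriv: "\<And>x. x \<in> {0..1} \<Longrightarrow> (g has_real_derivative g' x) (at x within {0..1})"
    and g'_cont: "continuous_on {0..1} g'"
    and g_zero: "g 0 = 0"
    and g'_nonzero: "\<And>x. x \<in> {0..1} \<Longrightarrow> g' x \<noteq> 0"
    and g_mono: "mono_on {0..1} g"
    and no_inflection: "monotone_on {0..1} (\<le>) (\<le>) g' \<or> monotone_on {0..1} (\<le>) (\<ge>) g'"
    and sigma0: "\<sigma>0 = (SUP x\<in>{0..1}. \<bar>g' x\<bar>)"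
    and delta0: "\<delta>0 = (INF x\<in>{0..1}. \<bar>g' x\<bar>)"
    and f_L1: "f absolutely_integrable_on {0..1}"
    and f_cont: "continuous_on {0<..1} f"
    and Psi: "\<Psi> = (\<lambda>x. f x / g' x) \<circ> inv_into {0..1} g"
    and Theta: "\<Theta> = (\<lambda>y. \<Psi> (g 1 * y))"
    and alpha: "-1 < \<alpha>" "\<alpha> < 1"
    and m: "m \<ge> 1"
    and Theta_type: "Type_zero \<alpha> (m + 1) \<Theta>"
  shows "\<exists>c>0. \<forall>\<kappa>>1. \<forall>n\<ge>1. \<forall>T.
           real n \<ge> ln (kappa_sigma \<kappa> \<sigma>0) / ln 2 \<and> node_choice m T \<longrightarrow>
           (let K = kappa_sigma \<kappa> \<sigma>0; \<beta> = K powr (1 / real n) - 1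
            in cmod (osc_integral f g \<kappa> (1 / K) 1 - filon_comp \<Psi> g g' T K \<kappa> n m)
                 \<le> c * \<bar>g 1\<bar> powr (-\<alpha>) * \<delta>0 powr (\<alpha> - 2) * \<sigma>0 * inverse (\<kappa>\<^sup>2)
                     * K powr (1 - \<alpha>) * ln K * \<beta> ^ (m - 1)
             \<and> int (card (filon_comp_evals g g' T K n m))
                 \<le> \<lceil>\<sigma>0 / \<delta>0\<rceil> * int n * int m + 1)"
proof -

  \<comment> \<open>Slope bounds for \<open>g\<close>\<close>
  have g'_pos: "g' x > 0" if "x \<in> {0..1}" for x
    using mono_on_deriv_nonneg[OF g_mono _ that g_deriv[OF that]] g'_nonzero[OF that] by simp
  have cabs: "continuous_on {0..1} (\<lambda>x. \<bar>g' x\<bar>)" by (intro continuous_intros g'_cont)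
  \<comment> \<open>By compactness the extrema are attained, so \<open>\<sigma>0\<close> and
    \<open>\<delta>0\<close> are values of \<open>\<bar>g' x\<bar>\<close>; in particular
    \<open>\<delta>0\<close> is positive.\<close>
  obtain x1 where x1: "x1 \<in> {0..1}" "\<And>x. x \<in> {0..1} \<Longrightarrow> \<bar>g' x\<bar> \<le> \<bar>g' x1\<bar>"
    using continuous_attains_sup[OF _ _ cabs] by auto
  obtain x0 where x0: "x0 \<in> {0..1}" "\<And>x. x \<in> {0..1} \<Longrightarrow> \<bar>g' x0\<bar> \<le> \<bar>g' x\<bar>"
    using continuous_attains_inf[OF _ _ cabs] by auto
  have "\<sigma>0 = \<bar>g' x1\<bar>" unfolding sigma0 using x1 by (intro cSup_eq_maximum) auto
  moreover have "\<delta>0 = \<bar>g' x0\<bar>" unfolding delta0 using x0 by (intro cInf_eq_minimum) auto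
  ultimately have g'_bounds: "\<delta>0 \<le> g' x" "g' x \<le> \<sigma>0" "\<bar>g' x\<bar> \<le> \<sigma>0" if "x \<in> {0..1}" for x
    using x0(2)[OF that] x1(2)[OF that] g'_pos[OF that] by auto
  have \<delta>: "0 < \<delta>0" "\<delta>0 \<le> \<sigma>0"
    using \<open>\<delta>0 = \<bar>g' x0\<bar>\<close> g'_pos[OF x0(1)] g'_bounds[OF x0(1)] by auto
  have mvt: "\<exists>z\<in>{x<..<y}. g y - g x = g' z * (y - x)" if "0 \<le> x" "x < y" "y \<le> 1" for x y
  proof (rule mvt_simple[OF \<open>x < y\<close>])
    fix z assume "x \<le> z" "z \<le> y"
    then show "(g has_derivative (*) (g' z)) (at z within {x..y})"
      using DERIV_subset[OF g_deriv[of z], of "{x..y}"] that by (auto simp: has_field_derivative_def)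
  qed
  have mono: "strict_mono_on {0..1} g"
  proof (rule strict_mono_onI)
    fix x y :: real assume xy: "x \<in> {0..1}" "y \<in> {0..1}" "x < y"
    then obtain z where z: "z \<in> {x<..<y}" "g y - g x = g' z * (y - x)" using mvt[of x y] by auto
    then have "g' z * (y - x) > 0" using g'_pos[of z] xy by (intro mult_pos_pos) auto
    then show "g x < g y" using z by simp
  qed
  have lower: "\<delta>0 * x \<le> g x" if x: "x \<in> {0..1}" for x
  proof (cases "x = 0")
    case False
    then obtain z where z: "z \<in> {0<..<x}" "g x = g' z * x" using mvt[of 0 x] x g_zero by auto
    then show ?thesis using g'_bounds(1)[of z] x by (auto intro!: mult_right_mono)
  qed (simp add: g_zero)
  have lip: "g y - g x \<le> max \<bar>g' a\<bar> \<bar>g' b\<bar> * (y - x)"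
    if le: "0 \<le> a" "a \<le> x" "x \<le> y" "y \<le> b" "b \<le> 1" for a b x y
  proof (cases "x = y")
    case False
    then have "0 \<le> x" "x < y" "y \<le> 1" using le by auto
    from mvt[OF this] obtain z where z: "z \<in> {x<..<y}" "g y - g x = g' z * (y - x)" by blast
    \<comment> \<open>A monotone derivative is largest at an endpoint, on the right if it increases
      and on the left if it decreases.\<close>
    have "g' z \<le> g' a \<or> g' z \<le> g' b"
      using no_inflection z le by (auto simp: monotone_on_def)
    then have "g' z \<le> max \<bar>g' a\<bar> \<bar>g' b\<bar>" by auto
    then show ?thesis unfolding z(2) using le by (intro mult_right_mono) auto
  qed simp
  have g1: "g 1 > 0" using lower[of 1] \<delta> by auto

  \<comment> \<open>Derivatives of \<Psi> by rescaling\<close>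
  from Theta_type obtain c where c: "c > 0"
    "\<And>x. x \<in> {0<..1} \<Longrightarrow> \<bar>iter_deriv {0<..1} (m + 1) \<Theta> x\<bar> \<le> c * x powr (\<alpha> - real (m + 1))"
    and Ck: "Ck_on (m + 1) {0<..1} \<Theta>"
    unfolding Type_zero_def by auto
  \<comment> \<open>The chain rule for \<Psi>(y) = \<Theta>(y / g 1): each differentiation yields a
    factor \<open>1 / g 1\<close>.\<close>
  define D where "D k y = iter_deriv {0<..1} k \<Theta> (y / g 1) / g 1 ^ k" for k y
  have D0: "D 0 = \<Psi>" using g1 by (auto simp: D_def Theta)
  have scale: "(\<lambda>y. y / g 1) ` {0<..g 1} \<subseteq> {0<..1}" using g1 by auto
  have deriv: "(D k has_real_derivative D (Suc k) y) (at y within {0<..g 1})"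
    if "k \<le> m" "y \<in> {0<..g 1}" for k y
  proof -
    have "(iter_deriv {0<..1} k \<Theta> has_real_derivative iter_deriv {0<..1} (Suc k) \<Theta> (y / g 1))
        (at (y / g 1) within (\<lambda>y. y / g 1) ` {0<..g 1})"
      by (rule DERIV_subset[OF iter_deriv_has_derivative[OF Ck] scale]) (use that g1 in auto)
    moreover have "((\<lambda>y. y / g 1) has_real_derivative 1 / g 1) (at y within {0<..g 1})"
      using g1 by (auto intro!: derivative_eq_intros)
    ultimately have "(iter_deriv {0<..1} k \<Theta> \<circ> (\<lambda>y. y / g 1) has_real_derivative
        iter_deriv {0<..1} (Suc k) \<Theta> (y / g 1) * (1 / g 1)) (at y within {0<..g 1})"
      by (rule DERIV_image_chain)
    from DERIV_cdivide[OF this, of "g 1 ^ k"] show ?thesis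
      by (simp add: D_def[abs_def] o_def mult_ac del: iter_deriv.simps)
  qed
  have cont: "continuous_on {0<..g 1} (D (Suc m))"
  proof -
    have "continuous_on {0<..1} (iter_deriv {0<..1} (Suc m) \<Theta>)" using Ck by (simp add: Ck_on_def)
    then have "continuous_on {0<..g 1} (\<lambda>y. iter_deriv {0<..1} (Suc m) \<Theta> (y / g 1))"
      by (rule continuous_on_compose2[OF _ _ scale]) (use g1 in \<open>auto intro!: continuous_intros\<close>)
    then show ?thesis unfolding D_def[abs_def] using g1 by (intro continuous_on_divide continuous_on_const) auto
  qed
  have bound: "\<bar>D (Suc m) y\<bar> \<le> c * g 1 powr (- \<alpha>) * y powr (\<alpha> - real (m + 1))"
    if y: "y \<in> {0<..g 1}" for y
  proof -
    \<comment> \<open>Rescaling the Type bound gives \<open>g 1\<close> the exponent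
      \<open>m + 1 - \<alpha>\<close>, and the \<open>m + 1\<close> differentiations reduce it to
      \<open>- \<alpha>\<close>.\<close>
    have "\<bar>D (Suc m) y\<bar> \<le> c * (y / g 1) powr (\<alpha> - real (m + 1)) / g 1 ^ Suc m"
      using c(2)[of "y / g 1"] y g1
      by (simp add: D_def abs_div_pos[symmetric] divide_right_mono del: iter_deriv.simps power_Suc)
    also have "\<dots> = c * y powr (\<alpha> - real (m + 1)) / (g 1 powr (\<alpha> - real (m + 1)) * g 1 powr (real (Suc m)))"
      using y g1 by (simp add: powr_divide powr_realpow del: power_Suc of_nat_Suc)
    also have "g 1 powr (\<alpha> - real (m + 1)) * g 1 powr (real (Suc m)) = g 1 powr \<alpha>"
      by (simp add: powr_add[symmetric])
    finally show ?thesis by (simp add: powr_minus divide_inverse mult_ac)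
  qed
  have f_eq: "f x = g' x * \<Psi> (g x)" if "x \<in> {0..1}" for x
  proof -
    have "inv_into {0..1} g (g x) = x"
      by (rule inv_into_f_f[OF strict_mono_on_imp_inj_on[OF mono] that])
    then show ?thesis using g'_nonzero[OF that] by (simp add: Psi)
  qed
  have cont\<Psi>: "continuous_on {0<..g 1} \<Psi>"
    unfolding D0[symmetric] by (rule DERIV_continuous_on) (rule deriv, auto)

  show ?thesis
  \<comment> \<open>Here 12 = 3 * 2 * 2: 3 from one panel, 2 from the number of panels in a block, 2
    from the bound on \<open>n\<close> times \<beta>. The factor \<open>c\<close> is the Type
    constant of \<Theta>.\<close>
  proof (intro exI[of _ "12 * c"] conjI allI impI)
    show "12 * c > 0" using c by simp
    fix \<kappa> :: real and n :: nat and T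
    assume \<kappa>: "\<kappa> > 1" and n1: "n \<ge> 1"
      and "real n \<ge> ln (kappa_sigma \<kappa> \<sigma>0) / ln 2 \<and> node_choice m T"
    define K where "K = kappa_sigma \<kappa> \<sigma>0"
    have n: "real n \<ge> ln K / ln 2" and T: "node_choice m T"
      using \<open>real n \<ge> _ \<and> _\<close> by (auto simp: K_def)
    have K: "K > 1" using \<kappa> mult_strict_mono[of 1 \<kappa> 1 \<sigma>0] by (auto simp: K_def kappa_sigma_def)
    have g'b: "g' x \<noteq> 0 \<and> \<bar>g' x\<bar> \<le> \<sigma>0" if "x \<in> {0..1}" for x
      using g'_nonzero g'_bounds that by auto
    have K0: "0 < 1 / K" "1 / K \<le> 1" using K by auto
    have "0 < \<delta>0 * (1 / K)" using \<delta> K0 by (intro mult_pos_pos)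
    then have gK: "g (1 / K) > 0" using lower[of "1 / K"] K0 by auto
    have "osc_integral f g \<kappa> (1 / K) 1
      = integral {g (1 / K)..g 1} (\<lambda>y. of_real (\<Psi> y) * exp (\<i> * of_real (\<kappa> * y)))"
    proof (rule osc_integral_substitution[where g' = g'])
      show "mono_on {1 / K..1} g" by (rule mono_on_subset[OF g_mono]) (use K0 in auto)
      show "continuous_on {g (1 / K)..g 1} \<Psi>"
        by (rule continuous_on_subset[OF cont\<Psi>]) (use gK in auto)
      fix x assume x: "x \<in> {1 / K..1}"
      then have x': "x \<in> {0..1}" using K0 unfolding atLeastAtMost_iff by linarith
      show "f x = g' x * \<Psi> (g x)" by (rule f_eq[OF x'])
      show "(g has_real_derivative g' x) (at x within {1 / K..1})"
        by (rule DERIV_subset[OF g_deriv[OF x']]) (use K0 in auto)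
    qed (rule K0)
    moreover have "n > 0" "\<kappa> > 0" using n1 \<kappa> by auto
    moreover have "cmod (integral {g (1 / K)..g 1} (\<lambda>y. of_real (D 0 y) * exp (\<i> * of_real (\<kappa> * y)))
        - filon_comp (D 0) g g' T K \<kappa> n m)
      \<le> 12 * (c * g 1 powr (- \<alpha>)) * \<delta>0 powr (\<alpha> - 2) * \<sigma>0 * inverse (\<kappa>\<^sup>2)
          * K powr (1 - \<alpha>) * ln K * (K powr (1 / real n) - 1) ^ (m - 1)"
    proof (rule filon_comp_error[OF m \<open>\<kappa> > 0\<close> K \<open>n > 0\<close> T n mono \<delta>])
      show "0 \<le> c * g 1 powr (- \<alpha>)" using c by simp
    qed (fact g'b lower lip deriv cont alpha(2) bound)+
    moreover have "card (filon_comp_evals g g' T K n m) \<le> nat \<lceil>\<sigma>0 / \<delta>0\<rceil> * n * m + 1"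
      by (rule card_filon_comp_evals[OF T m K \<open>n > 0\<close>])
        (use subdiv_num_bounds[where g = g and g' = g' and \<sigma> = \<sigma>0 and \<delta> = \<delta>0, OF K \<open>n > 0\<close> _ \<delta>(1) g'b lower] in auto)
    then have "int (card (filon_comp_evals g g' T K n m)) \<le> int (nat \<lceil>\<sigma>0 / \<delta>0\<rceil> * n * m + 1)"
      by (subst of_nat_le_iff)
    \<comment> \<open>Truncation by \<open>nat\<close> changes nothing because the quotient is
      positive.\<close>
    moreover have "int (nat \<lceil>\<sigma>0 / \<delta>0\<rceil>) = \<lceil>\<sigma>0 / \<delta>0\<rceil>"
      using divide_pos_pos[of \<sigma>0 \<delta>0] \<delta> by linarith
    ultimately show "let K = kappa_sigma \<kappa> \<sigma>0; \<beta> = K powr (1 / real n) - 1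
            in cmod (osc_integral f g \<kappa> (1 / K) 1 - filon_comp \<Psi> g g' T K \<kappa> n m)
                 \<le> 12 * c * \<bar>g 1\<bar> powr (-\<alpha>) * \<delta>0 powr (\<alpha> - 2) * \<sigma>0 * inverse (\<kappa>\<^sup>2)
                     * K powr (1 - \<alpha>) * ln K * \<beta> ^ (m - 1)
             \<and> int (card (filon_comp_evals g g' T K n m))
                 \<le> \<lceil>\<sigma>0 / \<delta>0\<rceil> * int n * int m + 1"
      using g1 by (simp add: Let_def mult_ac D0 flip: K_def)
  qed
qed

end
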